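(* Let $n\in\mathbb{N}$, let $S_1,\ldots,S_n$ be finite semigroups, let $S=\prod_{i=1}^n S_i$ be their direct product, and let $C=\{i\in\{1,\ldots,n\}: S_i\text{ is commutative}\}$ and $\mathit{NC}=\{i\in\{1,\ldots,n\}: S_i\text{ is not commutative}\}$. Suppose that $\mathit{NC}\neq\emptyset$. Then $$\omega(\mathcal{G}(S))=\Bigl(\prod_{i\in C}|S_i|\Bigr)\Bigl(\prod_{i\in\mathit{NC}}\bigl(|Z(S_i)|+\omega(\mathcal{G}(S_i))\bigr)\Bigr)-\prod_{i=1}^n|Z(S_i)|.$$
   Context: Semigroups are non-empty. The direct product $\prod_{i=1}^n S_i$ is the cartesian product with componentwise multiplication. The center of a semigroup $T$ is $Z(T)=\{x\in T: xy=yx \text{ for all } y\in T\}$ (possibly empty). For a finite non-commutative semigroup $T$, the commuting graph $\mathcal{G}(T)$ is the simple graph with vertex set $T\setminus Z(T)$ in which two distinct vertices $x,y$ are adjacent if and only if $xy=yx$. $\omega(G)$ denotes the clique number of a simple graph $G$ (the size of a largest set of pairwise adjacent vertices). An empty product equals $1$. *)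

theory Defs
  imports "HOL-Algebra.Congruence" "HOL-Library.FuncSet" "HOL-Library.Ramsey"
begin

text \<open>The class locale \<open>semigroup\<close> of HOL lives on whole types, and HOL-Algebra starts at
  records with a unit; the following record carries a set and a multiplication only.\<close>

record 'a sgrp = "'a partial_object" +
  mult :: "'a \<Rightarrow> 'a \<Rightarrow> 'a" (infixl \<open>\<cdot>\<index>\<close> 70)

locale is_semigroup =
  fixes T (structure)
  assumes nonempty: "carrier T \<noteq> {}"
    and closed: "\<lbrakk>x \<in> carrier T; y \<in> carrier T\<rbrakk> \<Longrightarrow> x \<cdot> y \<in> carrier T"
    and assoc: "\<lbrakk>x \<in> carrier T; y \<in> carrier T; z \<in> carrier T\<rbrakk>
      \<Longrightarrow> (x \<cdot> y) \<cdot> z = x \<cdot> (y \<cdot> z)"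

locale finite_semigroup = is_semigroup +
  assumes finite_carrier: "finite (carrier T)"

definition commutative :: "('a, 'b) sgrp_scheme \<Rightarrow> bool" where
  "commutative T \<longleftrightarrow> (\<forall>x\<in>carrier T. \<forall>y\<in>carrier T. x \<cdot>\<^bsub>T\<^esub> y = y \<cdot>\<^bsub>T\<^esub> x)"

definition center :: "('a, 'b) sgrp_scheme \<Rightarrow> 'a set" where
  "center T = {x \<in> carrier T. \<forall>y\<in>carrier T. x \<cdot>\<^bsub>T\<^esub> y = y \<cdot>\<^bsub>T\<^esub> x}"

definition direct_product :: "'i set \<Rightarrow> ('i \<Rightarrow> ('a, 'b) sgrp_scheme) \<Rightarrow> ('i \<Rightarrow> 'a) sgrp" where
  "direct_product I S =
     \<lparr>carrier = (\<Pi>\<^sub>E i\<in>I. carrier (S i)),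
      mult = (\<lambda>x y. \<lambda>i\<in>I. x i \<cdot>\<^bsub>S i\<^esub> y i)\<rparr>"

text \<open>A simple graph is a pair of a vertex set and a set of two-element subsets of it, the
  format that the predicate \<open>clique\<close> of the Ramsey theory expects for edges.\<close>

type_synonym 'v graph = "'v set \<times> 'v set set"

definition commuting_graph :: "('a, 'b) sgrp_scheme \<Rightarrow> 'a graph" where
  "commuting_graph T =
     (let V = carrier T - center T
      in (V, {{x, y} | x y. x \<in> V \<and> y \<in> V \<and> x \<noteq> y \<and> x \<cdot>\<^bsub>T\<^esub> y = y \<cdot>\<^bsub>T\<^esub> x}))"

text \<open>Meaningful for finite graphs only, since \<open>Max\<close> is unspecified on infinite sets.\<close>

definition clique_number :: "'v graph \<Rightarrow> nat" where
  "clique_number G = Max {card K | K. K \<subseteq> fst G \<and> clique K (snd G)}"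

lemma finite_semigroup_direct_product:
  assumes "finite I" and S: "\<And>i. i \<in> I \<Longrightarrow> finite_semigroup (S i)"
  shows "finite_semigroup (direct_product I S)"
proof
  have sg: "is_semigroup (S i)" if "i \<in> I" for i
    using S[OF that] by (simp add: finite_semigroup_def)
  show "carrier (direct_product I S) \<noteq> {}"
    using is_semigroup.nonempty[OF sg] by (auto simp: direct_product_def PiE_eq_empty_iff)
  show "x \<cdot>\<^bsub>direct_product I S\<^esub> y \<in> carrier (direct_product I S)"
    if "x \<in> carrier (direct_product I S)" "y \<in> carrier (direct_product I S)" for x y
    using that by (auto simp: direct_product_def PiE_iff intro: is_semigroup.closed[OF sg])
  show "x \<cdot>\<^bsub>direct_product I S\<^esub> y \<cdot>\<^bsub>direct_product I S\<^esub> z =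
      x \<cdot>\<^bsub>direct_product I S\<^esub> (y \<cdot>\<^bsub>direct_product I S\<^esub> z)"
    if "x \<in> carrier (direct_product I S)" "y \<in> carrier (direct_product I S)"
      "z \<in> carrier (direct_product I S)" for x y z
    using that
    by (auto simp: direct_product_def PiE_iff is_semigroup.assoc[OF sg] intro!: restrict_ext)
  show "finite (carrier (direct_product I S))"
    using assms(1) finite_semigroup.finite_carrier[OF S]
    by (simp add: direct_product_def finite_PiE)
qed

end

theory Submission
  imports Defs
begin

text \<open>The clique number of a commuting graph is not multiplicative, but the largest size of a set
  of pairwise commuting elements is. Call that size \<open>m(T)\<close>
  (\<open>commuting_number\<close>).

  Central elements commute with everything, so they can be adjoined to any set of pairwise
  commuting elements, while removing them from such a set leaves a clique of the commuting graph.
  Hence \<open>m(T) = |Z(T)| + \<omega>(\<G>(T))\<close> (\<open>commuting_number_eq\<close>), also when the centre is empty. If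
  \<open>T\<close> is commutative, then \<open>m(T) = |T|\<close>.

  Multiplication in a direct product is componentwise. So a product of commuting sets is commuting,
  and conversely a commuting set lies in the product of its projections, which are commuting.
  This gives \<open>m(S) = \<Prod> m(S\<^sub>i)\<close> (\<open>commuting_number_direct_product\<close>). In the same way
  \<open>Z(S) = \<Prod> Z(S\<^sub>i)\<close> (\<open>center_direct_product\<close>), and the formula is
  \<open>\<omega>(\<G>(S)) = m(S) - |Z(S)|\<close> with these products substituted.\<close>

definition commuting_set :: "('a, 'b) sgrp_scheme \<Rightarrow> 'a set \<Rightarrow> bool" where
  "commuting_set T A \<longleftrightarrow>
     A \<subseteq> carrier T \<and> (\<forall>x\<in>A. \<forall>y\<in>A. x \<cdot>\<^bsub>T\<^esub> y = y \<cdot>\<^bsub>T\<^esub> x)"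

definition commuting_number :: "('a, 'b) sgrp_scheme \<Rightarrow> nat" where
  "commuting_number T = Max (card ` {A. commuting_set T A})"

lemma finite_commuting_sets:
  assumes "finite (carrier T)"
  shows "finite {A. commuting_set T A}"
  by (rule finite_subset[of _ "Pow (carrier T)"]) (use assms in \<open>auto simp: commuting_set_def\<close>)

lemma card_le_commuting_number:
  assumes "finite (carrier T)" "commuting_set T A"
  shows "card A \<le> commuting_number T"
  unfolding commuting_number_def
  using assms finite_commuting_sets by (intro Max_ge) auto

lemma commuting_number_attained:
  assumes "finite (carrier T)"
  obtains A where "commuting_set T A" "card A = commuting_number T"
proof -
  have "commuting_set T {}" by (simp add: commuting_set_def)
  then have "commuting_number T \<in> card ` {A. commuting_set T A}"
    unfolding commuting_number_def
    using assms finite_commuting_sets by (intro Max_in) auto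
  then show thesis using that by auto
qed

lemma commuting_number_eqI:
  assumes "finite (carrier T)" "commuting_set T A" "card A = k"
    and "\<And>B. commuting_set T B \<Longrightarrow> card B \<le> k"
  shows "commuting_number T = k"
proof (rule le_antisym)
  obtain B where "commuting_set T B" "card B = commuting_number T"
    using assms(1) by (rule commuting_number_attained)
  then show "commuting_number T \<le> k"
    using assms(4) by metis
  show "k \<le> commuting_number T"
    using card_le_commuting_number[OF assms(1,2)] assms(3) by simp
qed

lemma commuting_number_commutative:
  assumes "finite (carrier T)" "commutative T"
  shows "commuting_number T = card (carrier T)"
  using assms
  by (intro commuting_number_eqI[where A = "carrier T"])
     (auto simp: commuting_set_def commutative_def intro: card_mono)

text \<open>Edges join distinct vertices only; the diagonal may be added to the commutation condition
  because every element commutes with itself.\<close>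

lemma clique_commuting_graph_iff:
  "K \<subseteq> fst (commuting_graph T) \<and> clique K (snd (commuting_graph T)) \<longleftrightarrow>
     commuting_set T K \<and> K \<inter> center T = {}"
proof -
  have edge: "{x, y} \<in> snd (commuting_graph T) \<longleftrightarrow>
      x \<in> fst (commuting_graph T) \<and> y \<in> fst (commuting_graph T) \<and> x \<noteq> y \<and>
      x \<cdot>\<^bsub>T\<^esub> y = y \<cdot>\<^bsub>T\<^esub> x" for x y
    unfolding commuting_graph_def Let_def fst_conv snd_conv mem_Collect_eq doubleton_eq_iff
    by metis
  have clique: "clique K (snd (commuting_graph T)) \<longleftrightarrow>
      (\<forall>x\<in>K. \<forall>y\<in>K. x \<cdot>\<^bsub>T\<^esub> y = y \<cdot>\<^bsub>T\<^esub> x)"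
    if K: "K \<subseteq> fst (commuting_graph T)"
    unfolding clique_def edge
  proof (intro iffI ballI impI)
    fix x y
    assume "\<forall>v\<in>K. \<forall>w\<in>K. v \<noteq> w \<longrightarrow> v \<in> fst (commuting_graph T) \<and>
      w \<in> fst (commuting_graph T) \<and> v \<noteq> w \<and> v \<cdot>\<^bsub>T\<^esub> w = w \<cdot>\<^bsub>T\<^esub> v" "x \<in> K" "y \<in> K"
    then show "x \<cdot>\<^bsub>T\<^esub> y = y \<cdot>\<^bsub>T\<^esub> x" by (cases "x = y") simp_all
  qed (use K in \<open>simp add: subset_iff\<close>)
  have "K \<subseteq> fst (commuting_graph T) \<longleftrightarrow> K \<subseteq> carrier T \<and> K \<inter> center T = {}"
    by (auto simp: commuting_graph_def Let_def)
  then show ?thesis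
    unfolding commuting_set_def using clique by metis
qed

lemma clique_number_commuting_graph:
  "clique_number (commuting_graph T) =
     Max (card ` {K. commuting_set T K \<and> K \<inter> center T = {}})"
  unfolding clique_number_def clique_commuting_graph_iff by (simp add: image_Collect)

text \<open>The centre together with a largest clique is commuting, which bounds the commuting number from
  below. For the upper bound, the non-central part of any commuting set is a clique.\<close>

lemma commuting_number_eq:
  assumes fin: "finite (carrier T)"
  shows "commuting_number T = card (center T) + clique_number (commuting_graph T)"
proof -
  let ?N = "{K. commuting_set T K \<and> K \<inter> center T = {}}"
  have finN: "finite (card ` ?N)"
    using finite_commuting_sets[OF fin] by (auto intro: finite_subset[rotated])
  have finZ: "finite (center T)"
    using fin by (simp add: center_def)
  have "{} \<in> ?N" by (simp add: commuting_set_def)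
  then have "clique_number (commuting_graph T) \<in> card ` ?N"
    unfolding clique_number_commuting_graph using finN by (intro Max_in) auto
  then obtain K where K: "commuting_set T K" "K \<inter> center T = {}"
      "card K = clique_number (commuting_graph T)"
    by auto
  show ?thesis
  proof (rule commuting_number_eqI[OF fin, of "center T \<union> K"])
    show "commuting_set T (center T \<union> K)"
      using K(1) by (auto simp: commuting_set_def center_def subset_iff)
    have "finite K"
      using K(1) fin by (auto simp: commuting_set_def intro: finite_subset)
    then show "card (center T \<union> K) = card (center T) + clique_number (commuting_graph T)"
      using K(2,3) finZ by (subst card_Un_disjoint) auto
    fix B assume B: "commuting_set T B"
    then have "B - center T \<in> ?N" by (auto simp: commuting_set_def)
    then have "card (B - center T) \<le> clique_number (commuting_graph T)"
      unfolding clique_number_commuting_graph using finN by (intro Max_ge) auto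
    moreover have "card B \<le> card (center T \<union> (B - center T))"
      using B fin finZ by (intro card_mono) (auto simp: commuting_set_def intro: finite_subset)
    ultimately show "card B \<le> card (center T) + clique_number (commuting_graph T)"
      using card_Un_le[of "center T" "B - center T"] by linarith
  qed
qed

lemma carrier_direct_product [simp]:
  "carrier (direct_product I S) = (\<Pi>\<^sub>E i\<in>I. carrier (S i))"
  by (simp add: direct_product_def)

lemma commute_direct_product_iff:
  "x \<cdot>\<^bsub>direct_product I S\<^esub> y = y \<cdot>\<^bsub>direct_product I S\<^esub> x \<longleftrightarrow>
     (\<forall>i\<in>I. x i \<cdot>\<^bsub>S i\<^esub> y i = y i \<cdot>\<^bsub>S i\<^esub> x i)"
  by (auto simp: direct_product_def fun_eq_iff restrict_def)

lemma center_direct_product: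
  "center (direct_product I S) = (\<Pi>\<^sub>E i\<in>I. center (S i))"
proof
  show "center (direct_product I S) \<subseteq> (\<Pi>\<^sub>E i\<in>I. center (S i))"
  proof
    fix x assume x: "x \<in> center (direct_product I S)"
    then have xc: "x \<in> (\<Pi>\<^sub>E i\<in>I. carrier (S i))" by (simp add: center_def)
    have "x i \<cdot>\<^bsub>S i\<^esub> y = y \<cdot>\<^bsub>S i\<^esub> x i" if "i \<in> I" "y \<in> carrier (S i)" for i y
    proof -
      \<comment> \<open>An arbitrary \<open>y\<close> of the \<open>i\<close>-th factor has to be completed to an element of the product;
        without identity elements to pad with, \<open>x\<close> itself supplies the other coordinates.\<close>
      have "x(i := y) \<in> (\<Pi>\<^sub>E i\<in>I. carrier (S i))"
        using xc that by (auto simp: PiE_iff extensional_def)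
      then have "x \<cdot>\<^bsub>direct_product I S\<^esub> x(i := y) = x(i := y) \<cdot>\<^bsub>direct_product I S\<^esub> x"
        using x by (simp add: center_def)
      then show ?thesis
        using that(1) by (auto simp: commute_direct_product_iff dest: bspec[of _ _ i])
    qed
    then show "x \<in> (\<Pi>\<^sub>E i\<in>I. center (S i))"
      using xc by (auto simp: center_def PiE_iff)
  qed
  show "(\<Pi>\<^sub>E i\<in>I. center (S i)) \<subseteq> center (direct_product I S)"
    by (auto simp: center_def PiE_iff commute_direct_product_iff)
qed

lemma commuting_set_PiE:
  assumes "\<And>i. i \<in> I \<Longrightarrow> commuting_set (S i) (A i)"
  shows "commuting_set (direct_product I S) (\<Pi>\<^sub>E i\<in>I. A i)"
  using assms by (fastforce simp: commuting_set_def commute_direct_product_iff PiE_iff)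

lemma commuting_set_projection:
  assumes "commuting_set (direct_product I S) B" "i \<in> I"
  shows "commuting_set (S i) ((\<lambda>x. x i) ` B)"
  using assms by (fastforce simp: commuting_set_def commute_direct_product_iff PiE_iff)

text \<open>The product of largest commuting sets of the factors realizes the product of their sizes. No
  commuting set is larger, since it is contained in the product of its projections.\<close>

lemma commuting_number_direct_product:
  assumes I: "finite I" and fin: "\<And>i. i \<in> I \<Longrightarrow> finite (carrier (S i))"
  shows "commuting_number (direct_product I S) = (\<Prod>i\<in>I. commuting_number (S i))"
proof -
  have "\<exists>A. commuting_set (S i) A \<and> card A = commuting_number (S i)" if "i \<in> I" for i
    using commuting_number_attained[OF fin[OF that]] by metis
  then obtain A where A: "\<And>i. i \<in> I \<Longrightarrow> commuting_set (S i) (A i)"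
      "\<And>i. i \<in> I \<Longrightarrow> card (A i) = commuting_number (S i)"
    by metis
  show ?thesis
  proof (rule commuting_number_eqI[of _ "\<Pi>\<^sub>E i\<in>I. A i"])
    show "finite (carrier (direct_product I S))"
      using I fin by (simp add: finite_PiE)
    show "commuting_set (direct_product I S) (\<Pi>\<^sub>E i\<in>I. A i)"
      using A(1) by (rule commuting_set_PiE)
    show "card (\<Pi>\<^sub>E i\<in>I. A i) = (\<Prod>i\<in>I. commuting_number (S i))"
      using I A(2) by (simp add: card_PiE)
    fix B assume B: "commuting_set (direct_product I S) B"
    define P where "P i = (\<lambda>x. x i) ` B" for i
    have P: "commuting_set (S i) (P i)" if "i \<in> I" for i
      unfolding P_def using B that by (rule commuting_set_projection)
    then have "finite (P i)" if "i \<in> I" for i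
      using that fin unfolding commuting_set_def by (meson finite_subset)
    then have "finite (\<Pi>\<^sub>E i\<in>I. P i)"
      using I by (intro finite_PiE) auto
    moreover have "B \<subseteq> (\<Pi>\<^sub>E i\<in>I. P i)"
      using B by (auto simp: commuting_set_def P_def PiE_iff)
    ultimately have "card B \<le> card (\<Pi>\<^sub>E i\<in>I. P i)"
      by (rule card_mono)
    also have "\<dots> = (\<Prod>i\<in>I. card (P i))"
      using I by (simp add: card_PiE)
    also have "\<dots> \<le> (\<Prod>i\<in>I. commuting_number (S i))"
      using P fin by (intro prod_mono) (auto intro: card_le_commuting_number)
    finally show "card B \<le> (\<Prod>i\<in>I. commuting_number (S i))" .
  qed
qed

theorem theorem4p6:
  fixes n :: nat and S :: "nat \<Rightarrow> 'a sgrp" and C NC :: "nat set"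
  assumes "\<And>i. i \<in> {1..n} \<Longrightarrow> finite_semigroup (S i)"
    and "C = {i \<in> {1..n}. commutative (S i)}"
    and "NC = {i \<in> {1..n}. \<not> commutative (S i)}"
    and "NC \<noteq> {}"
  shows "int (clique_number (commuting_graph (direct_product {1..n} S))) =
      (\<Prod>i\<in>C. int (card (carrier (S i)))) *
      (\<Prod>i\<in>NC. int (card (center (S i))) + int (clique_number (commuting_graph (S i))))
      - (\<Prod>i\<in>{1..n}. int (card (center (S i))))"
proof -
  let ?S = "direct_product {1..n} S"
  have fin: "finite (carrier (S i))" if "i \<in> {1..n}" for i
    using finite_semigroup.finite_carrier[OF assms(1)[OF that]] .
  have "finite (carrier ?S)"
    using fin by (auto intro!: finite_PiE)
  then have "int (clique_number (commuting_graph ?S)) =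
      int (commuting_number ?S) - int (card (center ?S))"
    by (simp add: commuting_number_eq)
  also have "int (card (center ?S)) = (\<Prod>i\<in>{1..n}. int (card (center (S i))))"
    by (simp add: center_direct_product card_PiE)
  also have "int (commuting_number ?S) = (\<Prod>i\<in>{1..n}. int (commuting_number (S i)))"
    by (subst commuting_number_direct_product) (use fin in auto)
  also have "(\<Prod>i\<in>{1..n}. int (commuting_number (S i))) =
      (\<Prod>i\<in>C. int (commuting_number (S i))) *
      (\<Prod>i\<in>NC. int (commuting_number (S i)))"
  proof -
    have "{1..n} = C \<union> NC" "C \<inter> NC = {}" "finite C" "finite NC"
      using assms(2,3) by auto
    then show ?thesis
      by (simp only: prod.union_disjoint)
  qed
  also have "(\<Prod>i\<in>C. int (commuting_number (S i))) = (\<Prod>i\<in>C. int (card (carrier (S i))))"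
    using assms(2) fin by (intro prod.cong) (auto simp: commuting_number_commutative)
  also have "(\<Prod>i\<in>NC. int (commuting_number (S i))) =
      (\<Prod>i\<in>NC. int (card (center (S i))) + int (clique_number (commuting_graph (S i))))"
    using assms(3) fin by (intro prod.cong) (auto simp: commuting_number_eq)
  finally show ?thesis .
qed

end
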